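(* Let $t\ge 2$ be an integer and let $A$ be a $t\times t$-partite zero-one matrix. Then $$\operatorname{ex}(n,A)<n^{2-\frac{1}{t}+o(1)},$$ that is, for every $\varepsilon>0$ there exists $n_0$ such that $\operatorname{ex}(n,A)<n^{2-\frac1t+\varepsilon}$ for all $n\ge n_0$.
   Context: A zero-one matrix $M$ contains a zero-one matrix $A$ if one can delete some rows and columns of $M$ and turn some $1$-entries into $0$-entries so that the resulting matrix is $A$. The weight of a matrix is its number of $1$-entries, and $\operatorname{ex}(n,A)$ is the maximum weight of an $n\times n$ zero-one matrix not containing $A$. A matrix is column-$t$-partite if its columns can be cut into $t$ consecutive intervals, giving $t$ submatrices, such that every row of each submatrix contains at most one $1$-entry; it is row-$t$-partite if its rows can be cut into $t$ consecutive intervals, giving $t$ submatrices, such that every column of each submatrix contains at most one $1$-entry. A matrix is $t\times t$-partite if it is both row-$t$-partite and column-$t$-partite. *)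

theory Defs
  imports Complex_Main
begin

text \<open>A zero-one matrix with k rows and l columns is represented by a predicate
  A :: nat \<Rightarrow> nat \<Rightarrow> bool (A i j means the (i,j) entry is 1), rows indexed 0..<k,
  columns 0..<l, and all 1-entries inside this range.\<close>

definition zo_matrix :: "nat \<Rightarrow> nat \<Rightarrow> (nat \<Rightarrow> nat \<Rightarrow> bool) \<Rightarrow> bool" where
  "zo_matrix k l A \<longleftrightarrow> (\<forall>i j. A i j \<longrightarrow> i < k \<and> j < l)"

definition contains ::
  "nat \<Rightarrow> nat \<Rightarrow> (nat \<Rightarrow> nat \<Rightarrow> bool) \<Rightarrow> nat \<Rightarrow> nat \<Rightarrow> (nat \<Rightarrow> nat \<Rightarrow> bool) \<Rightarrow> bool" where
  "contains m n M k l A \<longleftrightarrow>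
     (\<exists>r c :: nat \<Rightarrow> nat.
        (\<forall>i<k. r i < m) \<and> (\<forall>i j. i < j \<and> j < k \<longrightarrow> r i < r j) \<and>
        (\<forall>j<l. c j < n) \<and> (\<forall>i j. i < j \<and> j < l \<longrightarrow> c i < c j) \<and>
        (\<forall>i<k. \<forall>j<l. A i j \<longrightarrow> M (r i) (c j)))"

definition weight :: "nat \<Rightarrow> nat \<Rightarrow> (nat \<Rightarrow> nat \<Rightarrow> bool) \<Rightarrow> nat" where
  "weight m n M = card {(i, j). i < m \<and> j < n \<and> M i j}"

text \<open>ex(n,A): maximum weight of an n x n zero-one matrix not containing A
  (0 if there is no such matrix).\<close>

definition ex :: "nat \<Rightarrow> nat \<Rightarrow> nat \<Rightarrow> (nat \<Rightarrow> nat \<Rightarrow> bool) \<Rightarrow> nat" where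
  "ex n k l A = Max (insert 0 {weight n n M | M. zo_matrix n n M \<and> \<not> contains n n M k l A})"

definition col_partite :: "nat \<Rightarrow> nat \<Rightarrow> nat \<Rightarrow> (nat \<Rightarrow> nat \<Rightarrow> bool) \<Rightarrow> bool" where
  "col_partite t k l A \<longleftrightarrow>
     (\<exists>b :: nat \<Rightarrow> nat. b 0 = 0 \<and> b t = l \<and> (\<forall>s<t. b s < b (Suc s)) \<and>
        (\<forall>s<t. \<forall>i<k. \<forall>j1 j2. b s \<le> j1 \<and> j1 < j2 \<and> j2 < b (Suc s) \<longrightarrow> \<not> (A i j1 \<and> A i j2)))"

definition row_partite :: "nat \<Rightarrow> nat \<Rightarrow> nat \<Rightarrow> (nat \<Rightarrow> nat \<Rightarrow> bool) \<Rightarrow> bool" where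
  "row_partite t k l A \<longleftrightarrow>
     (\<exists>b :: nat \<Rightarrow> nat. b 0 = 0 \<and> b t = k \<and> (\<forall>s<t. b s < b (Suc s)) \<and>
        (\<forall>s<t. \<forall>j<l. \<forall>i1 i2. b s \<le> i1 \<and> i1 < i2 \<and> i2 < b (Suc s) \<longrightarrow> \<not> (A i1 j \<and> A i2 j)))"

definition tt_partite :: "nat \<Rightarrow> nat \<Rightarrow> nat \<Rightarrow> (nat \<Rightarrow> nat \<Rightarrow> bool) \<Rightarrow> bool" where
  "tt_partite t k l A \<longleftrightarrow> row_partite t k l A \<and> col_partite t k l A"

end

theory Submission
  imports Defs "HOL-Library.Ramsey"
begin

text \<open>Only the following consequence of being \<open>t \<times> t\<close>-partite matters: every row of \<open>A\<close> has at most
  \<open>t\<close> one-entries. Write row indices in base \<open>s \<approx> n\<^sup>1\<^sup>/\<^sup>L\<close> with \<open>L\<close> a large constant. A level \<open>\<mu>\<close> is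
  active for \<open>r \<in> X\<close> if some element of \<open>X\<close> exceeds \<open>r\<close> at digit \<open>\<mu>\<close> and agrees with it at all higher
  digits. Elements witnessing distinct active levels of the same \<open>r\<close> are ordered as the
  levels, and all but \<open>O(s\<^sup>k)\<close> elements of \<open>X\<close> have at least \<open>k\<close> active levels.
  Choose \<open>t\<close> random rows. Their common neighbourhood has expected size at least \<open>n\<close> to the power \<open>t\<epsilon>\<close>,
  whereas the expected number of \<open>t\<close>-sets \<open>T\<close> of columns whose set of common rows contains all \<open>t\<close>
  chosen rows, each with few active levels, is only \<open>O(s\<^sup>k\<^sup>t)\<close>. Delete one column
  from each such \<open>T\<close> and colour every remaining \<open>T\<close> by one of its chosen rows having at least \<open>k\<close>
  active levels, together with these levels. The number of colours is bounded, so Ramsey's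
  theorem gives columns on which the row and the levels are constant; the \<open>i\<close>-th row of \<open>A\<close>
  is then embedded at the \<open>i\<close>-th level.\<close>

section \<open>Ramsey's theorem with a finite set of colours\<close>

text \<open>\<open>ramsey_full\<close> is transported along an enumeration \<open>g\<close> of the
  vertices and a bijection \<open>e\<close> from the colours to an initial segment. \<open>N\<close>
  is fixed before \<open>V\<close> and \<open>f\<close>.\<close>

lemma ramsey_colouring:
  fixes m t :: nat and C :: "'c set"
  assumes "finite C"
  obtains N where "\<And>(V :: 'a set) f. \<lbrakk>finite V; N \<le> card V; \<And>T. T \<in> nsets V t \<Longrightarrow> f T \<in> C\<rbrakk>
    \<Longrightarrow> \<exists>H \<in> nsets V m. \<exists>c \<in> C. \<forall>T \<in> nsets H t. f T = c"
proof -
  obtain N :: nat where N: "partn_lst {..<N} (replicate (card C) m) t"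
    using ramsey_full by blast
  obtain e where e: "bij_betw e C {0..<card C}"
    using ex_bij_betw_finite_nat[OF assms] by blast
  show thesis
  proof (rule that)
    fix V :: "'a set" and f
    assume V: "finite V" "N \<le> card V" and f: "\<And>T. T \<in> nsets V t \<Longrightarrow> f T \<in> C"
    obtain g where g: "bij_betw g {0..<card V} V"
      using ex_bij_betw_nat_finite[OF V(1)] by blast
    have inj: "inj_on g {..<N}" and im: "g ` {..<N} \<subseteq> V"
      using g V(2) by (auto simp: bij_betw_def intro: inj_on_subset)
    have img: "g ` T \<in> nsets V q" if "T \<in> nsets {..<N} q" for T q
      using that im inj by (auto simp: nsets_def card_image inj_on_subset)
    have "(\<lambda>T. e (f (g ` T))) \<in> nsets {..<N} t \<rightarrow> {..<card C}"
      using e f img by (force simp: bij_betw_def)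
    then obtain i H where i: "i < card C" and H: "H \<in> nsets {..<N} m"
      and mono: "(\<lambda>T. e (f (g ` T))) ` nsets H t \<subseteq> {i}"
      by (rule partn_lstE[OF N]) auto
    obtain c where c: "c \<in> C" "e c = i"
      using e i by (metis atLeast0LessThan bij_betw_iff_bijections lessThan_iff)
    have "f T = c" if T: "T \<in> nsets (g ` H) t" for T
    proof -
      have HN: "H \<subseteq> {..<N}" using H by (auto simp: nsets_def)
      obtain T' where T': "T' \<subseteq> H" "T = g ` T'"
        using T by (auto simp: nsets_def subset_image_iff)
      have "inj_on g T'" using inj T' HN by (meson inj_on_subset subset_trans)
      then have "card T' = card T" by (simp add: T' card_image)
      moreover have "finite T'"
        using T'(1) HN by (meson finite_lessThan finite_subset)
      ultimately have "T' \<in> nsets H t" using T T' by (auto simp: nsets_def)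
      then have "e (f T) = i" using mono T' by auto
      moreover have "f T \<in> C"
        using f img T' \<open>T' \<in> nsets H t\<close> HN by (auto simp: nsets_def)
      ultimately show ?thesis
        using c e by (auto simp: bij_betw_def inj_on_def)
    qed
    then show "\<exists>H \<in> nsets V m. \<exists>c \<in> C. \<forall>T \<in> nsets H t. f T = c"
      using img[OF H] c by blast
  qed
qed

section \<open>Digit expansions and active levels\<close>

text \<open>Equal quotients mean equal higher digits, so comparing the quotients one level down
  compares the digits at \<mu>.\<close>

definition digit_window :: "nat \<Rightarrow> nat \<Rightarrow> nat \<Rightarrow> nat set" where
  "digit_window s r \<mu> = {x. x div s ^ Suc \<mu> = r div s ^ Suc \<mu> \<and> r div s ^ \<mu> < x div s ^ \<mu>}"

definition active_levels :: "nat \<Rightarrow> nat \<Rightarrow> nat set \<Rightarrow> nat \<Rightarrow> nat set" where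
  "active_levels s L X r = {\<mu>. \<mu> < L \<and> X \<inter> digit_window s r \<mu> \<noteq> {}}"

text \<open>Division by \<open>s ^ \<nu>\<close> discards level \<mu>, so \<open>x\<close> then has
  the same quotient as \<open>r\<close>, whereas \<open>y\<close> has a larger one.\<close>

lemma digit_window_less:
  assumes "\<mu> < \<nu>" "x \<in> digit_window s r \<mu>" "y \<in> digit_window s r \<nu>"
  shows "x < y"
proof -
  obtain d where d: "\<nu> = Suc \<mu> + d" using assms(1) less_iff_Suc_add by auto
  have "x div s ^ \<nu> = (x div s ^ Suc \<mu>) div s ^ d"
    by (simp only: d power_add div_mult2_eq)
  also have "\<dots> = (r div s ^ Suc \<mu>) div s ^ d"
    using assms(2) by (simp add: digit_window_def)
  also have "\<dots> = r div s ^ \<nu>"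
    by (simp only: d power_add div_mult2_eq)
  also have "\<dots> < y div s ^ \<nu>"
    using assms(3) by (simp add: digit_window_def)
  finally show ?thesis
    by (meson div_le_mono leD leI)
qed

text \<open>Both quotients vanish at level \<open>L\<close>; just below the least level at which the
  quotients agree lies the highest differing digit.\<close>

lemma exists_first_differing_digit:
  fixes x y s :: nat
  assumes "x < y" "y < s ^ L"
  shows "\<exists>\<mu><L. y \<in> digit_window s x \<mu>"
proof -
  define \<mu> where "\<mu> = (LEAST \<mu>. x div s ^ \<mu> = y div s ^ \<mu>)"
  have L: "x div s ^ L = y div s ^ L" using assms by simp
  have eq: "x div s ^ \<mu> = y div s ^ \<mu>" unfolding \<mu>_def using L by (rule LeastI)
  have "\<mu> \<noteq> 0" using eq assms by (cases \<mu>) auto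
  then obtain \<nu> where \<nu>: "\<mu> = Suc \<nu>" by (cases \<mu>) auto
  have "\<mu> \<le> L" unfolding \<mu>_def using L by (rule Least_le)
  moreover have "x div s ^ \<nu> \<noteq> y div s ^ \<nu>"
    using not_less_Least[of \<nu> "\<lambda>\<mu>. x div s ^ \<mu> = y div s ^ \<mu>"] \<nu> \<mu>_def by auto
  moreover have "x div s ^ \<nu> \<le> y div s ^ \<nu>" using assms by (simp add: div_le_mono)
  ultimately show ?thesis
    using eq \<nu> by (intro exI[of _ \<nu>]) (auto simp: digit_window_def)
qed

text \<open>An element of \<open>X\<close> is determined by its set of active levels together with its digits there:
  at the highest level where two elements differ, the smaller one is active.\<close>

lemma card_few_active_levels:
  assumes X: "X \<subseteq> {..<s ^ L}" and s: "s > 0"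
  shows "card {r \<in> X. card (active_levels s L X r) < k} \<le> 2 ^ L * s ^ k"
proof -
  let ?A = "active_levels s L X"
  let ?G = "{G \<in> Pow {..<L}. card G < k}"
  let ?P = "\<lambda>G. \<Pi>\<^sub>E \<mu>\<in>G. {..<s}"
  define enc where "enc r = (?A r, \<lambda>\<mu>\<in>?A r. r div s ^ \<mu> mod s)" for r
  have less_case: False if xy: "x \<in> X" "y \<in> X" "x < y" "enc x = enc y" for x y
  proof -
    obtain \<mu> where \<mu>: "\<mu> < L" "y \<in> digit_window s x \<mu>"
      using exists_first_differing_digit[OF xy(3), of s L] xy(2) X by auto
    then have "\<mu> \<in> ?A x" using xy(2) by (auto simp: active_levels_def)
    moreover have "?A x = ?A y" using xy(4) by (simp add: enc_def)
    moreover have "(\<lambda>\<mu>\<in>?A x. x div s ^ \<mu> mod s) \<mu> = (\<lambda>\<mu>\<in>?A y. y div s ^ \<mu> mod s) \<mu>"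
      using xy(4) unfolding enc_def by (metis prod.inject)
    ultimately have "x div s ^ \<mu> mod s = y div s ^ \<mu> mod s"
      by (metis (no_types, lifting) restrict_apply')
    moreover have "x div s ^ \<mu> div s = y div s ^ \<mu> div s"
      using \<mu> by (simp add: digit_window_def div_mult2_eq[symmetric] mult.commute)
    moreover have "a = b" if "a mod s = b mod s" "a div s = b div s" for a b
      using that by (metis div_mult_mod_eq)
    ultimately have "x div s ^ \<mu> = y div s ^ \<mu>" by blast
    then show False using \<mu> by (simp add: digit_window_def)
  qed
  have "inj_on enc {r \<in> X. card (?A r) < k}"
    by (rule inj_onI) (metis (mono_tags, lifting) less_case linorder_neqE_nat mem_Collect_eq)
  \<comment> \<open>There are at most \<open>2 ^ L\<close> level sets \<open>G\<close>, each with
    fewer than \<open>k\<close> levels and hence at most \<open>s ^ k\<close> digit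
    assignments.\<close>
  moreover have "enc ` {r \<in> X. card (?A r) < k} \<subseteq> Sigma ?G ?P"
    using s by (auto simp: enc_def restrict_PiE_iff) (auto simp: active_levels_def)
  moreover have fin: "finite G" if "G \<in> ?G" for G
    using that finite_subset by auto
  then have finS: "finite (Sigma ?G ?P)"
    by (intro finite_SigmaI finite_PiE) auto
  ultimately have "card {r \<in> X. card (?A r) < k} \<le> card (Sigma ?G ?P)"
    by (meson card_inj_on_le)
  also have "\<dots> = (\<Sum>G\<in>?G. card (?P G))"
    using fin by (intro card_SigmaI) (auto intro!: finite_PiE)
  also have "\<dots> \<le> (\<Sum>G\<in>?G. s ^ k)"
  proof (rule sum_mono)
    fix G assume G: "G \<in> ?G"
    have "card (?P G) = s ^ card G" by (simp add: card_PiE[OF fin[OF G]])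
    also have "\<dots> \<le> s ^ k" using G s by (intro power_increasing) auto
    finally show "card (?P G) \<le> s ^ k" .
  qed
  also have "\<dots> = card ?G * s ^ k" by simp
  also have "card ?G \<le> card (Pow {..<L})" by (intro card_mono) auto
  finally show ?thesis by (simp add: card_Pow mult_right_mono)
qed

section \<open>Dependent random choice\<close>

definition common_rows :: "nat \<Rightarrow> (nat \<Rightarrow> nat \<Rightarrow> bool) \<Rightarrow> nat set \<Rightarrow> nat set" where
  "common_rows n M T = {i. i < n \<and> (\<forall>j\<in>T. M i j)}"

text \<open>Tangent line at \<open>m\<close>: after Bernoulli's inequality, the linear terms have
  nonnegative sum because \<open>d\<close> has mean at least \<open>m\<close>.\<close>

lemma sum_power_ge_mean_power:
  fixes d :: "'a \<Rightarrow> real" and m :: real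
  assumes "finite I" "\<And>i. i \<in> I \<Longrightarrow> 0 \<le> d i" "m > 0" "card I * m \<le> sum d I"
  shows "card I * m ^ t \<le> (\<Sum>i\<in>I. d i ^ t)"
proof -
  have "m ^ t + real t * m ^ t * (d i / m - 1) \<le> d i ^ t" if "i \<in> I" for i
  proof -
    have "1 + real t * (d i / m - 1) \<le> (1 + (d i / m - 1)) ^ t"
      using assms that by (intro Bernoulli_inequality) auto
    then have "m ^ t * (1 + real t * (d i / m - 1)) \<le> m ^ t * (d i / m) ^ t"
      using assms by (intro mult_left_mono) auto
    also have "\<dots> = d i ^ t" using assms by (simp add: power_divide)
    finally show ?thesis by (simp add: algebra_simps)
  qed
  then have "(\<Sum>i\<in>I. m ^ t + real t * m ^ t * (d i / m - 1)) \<le> (\<Sum>i\<in>I. d i ^ t)"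
    by (rule sum_mono)
  also have "(\<Sum>i\<in>I. m ^ t + real t * m ^ t * (d i / m - 1))
      = card I * m ^ t + real t * m ^ t * (sum d I / m - card I)"
    by (simp add: sum.distrib sum_distrib_left[symmetric] sum_subtractf sum_divide_distrib[symmetric])
  finally have "card I * m ^ t + real t * m ^ t * (sum d I / m - card I) \<le> (\<Sum>i\<in>I. d i ^ t)" .
  moreover have "0 \<le> real t * m ^ t * (sum d I / m - card I)"
    using assms(3,4) by (intro mult_nonneg_nonneg) (auto simp: le_divide_eq)
  ultimately show ?thesis by linarith
qed

lemma sum_card_swap:
  assumes "finite A" "finite B"
  shows "(\<Sum>a\<in>A. card {b \<in> B. P a b}) = (\<Sum>b\<in>B. card {a \<in> A. P a b})"
proof -
  have "(\<Sum>a\<in>A. card {b \<in> B. P a b}) = (\<Sum>a\<in>A. \<Sum>b\<in>B. if P a b then 1 else 0)"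
    using assms by (intro sum.cong) (auto simp: sum.If_cases Int_def)
  also have "\<dots> = (\<Sum>b\<in>B. \<Sum>a\<in>A. if P a b then 1 else 0)" by (rule sum.swap)
  also have "\<dots> = (\<Sum>b\<in>B. card {a \<in> A. P a b})"
    using assms by (intro sum.cong) (auto simp: sum.If_cases Int_def)
  finally show ?thesis .
qed

text \<open>Dependent random choice, with \<open>Bad T\<close> an exceptional set of rows for each column set \<open>T\<close>:
  \<open>V\<close> arises from the common neighbourhood of \<open>t\<close> random rows by deleting
  one column from each \<open>T\<close> for which all \<open>t\<close> rows are exceptional.\<close>

lemma dependent_random_choice:
  fixes m :: real
  assumes n: "n > 0" and t: "t > 0" and m: "m > 0" and w: "real n * m \<le> weight n n M"
    and B: "\<And>T. T \<subseteq> {..<n} \<Longrightarrow> card (common_rows n M T \<inter> Bad T) \<le> B"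
  obtains V r where "V \<subseteq> {..<n}" "real n * m ^ t \<le> real n ^ t * (real (card V) + real B ^ t)"
    "\<And>T. T \<in> nsets V t \<Longrightarrow> \<exists>a<t. r a \<in> common_rows n M T - Bad T"
proof -
  let ?R = "\<Pi>\<^sub>E a\<in>{..<t}. {..<n}"
  let ?S = "nsets {..<n} t"
  define U where "U r = {j \<in> {..<n}. \<forall>a<t. M (r a) j}" for r
  define E where "E r = {T \<in> ?S. \<forall>a<t. r a \<in> common_rows n M T \<inter> Bad T}" for r
  have finR: "finite ?R" by (intro finite_PiE) auto
  have cardR: "card ?R = n ^ t" by (simp add: card_PiE)
  have finS: "finite ?S" by (simp add: finite_imp_finite_nsets)
  have "(\<Sum>r\<in>?R. card (U r)) = (\<Sum>j<n. card {r \<in> ?R. \<forall>a<t. M (r a) j})"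
    unfolding U_def using finR by (intro sum_card_swap) auto
  \<comment> \<open>The chosen rows may repeat, so each column is counted by all
    \<open>t\<close>-tuples of its neighbours.\<close>
  also have "\<dots> = (\<Sum>j<n. card {i. i < n \<and> M i j} ^ t)"
  proof (rule sum.cong[OF refl])
    fix j
    have "{r \<in> ?R. \<forall>a<t. M (r a) j} = (\<Pi>\<^sub>E a\<in>{..<t}. {i. i < n \<and> M i j})"
      by (fastforce simp: PiE_iff)
    then show "card {r \<in> ?R. \<forall>a<t. M (r a) j} = card {i. i < n \<and> M i j} ^ t"
      by (simp add: card_PiE)
  qed
  finally have sumU: "(\<Sum>r\<in>?R. card (U r)) = (\<Sum>j<n. card {i. i < n \<and> M i j} ^ t)" .
  have wsum: "weight n n M = (\<Sum>j<n. card {i. i < n \<and> M i j})"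
  proof -
    have "{(i, j). i < n \<and> j < n \<and> M i j} = prod.swap ` Sigma {..<n} (\<lambda>j. {i. i < n \<and> M i j})"
      by force
    then show ?thesis
      by (simp add: weight_def card_image)
  qed
  have "real n * m ^ t \<le> (\<Sum>j<n. real (card {i. i < n \<and> M i j}) ^ t)"
    using sum_power_ge_mean_power[of "{..<n}" "\<lambda>j. real (card {i. i < n \<and> M i j})" m t] m w wsum
    by simp
  also have "\<dots> = (\<Sum>r\<in>?R. real (card (U r)))"
    using arg_cong[OF sumU, of real] by simp
  finally have U_ge: "real n * m ^ t \<le> (\<Sum>r\<in>?R. real (card (U r)))" .
  have "(\<Sum>r\<in>?R. card (E r)) = (\<Sum>T\<in>?S. card {r \<in> ?R. \<forall>a<t. r a \<in> common_rows n M T \<inter> Bad T})"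
    unfolding E_def using finR finS by (rule sum_card_swap)
  also have "\<dots> \<le> (\<Sum>T\<in>?S. B ^ t)"
  proof (rule sum_mono)
    fix T assume T: "T \<in> ?S"
    have "{r \<in> ?R. \<forall>a<t. r a \<in> common_rows n M T \<inter> Bad T}
        = (\<Pi>\<^sub>E a\<in>{..<t}. common_rows n M T \<inter> Bad T)"
      by (fastforce simp: PiE_iff common_rows_def)
    moreover have "card (common_rows n M T \<inter> Bad T) \<le> B"
      using T by (intro B) (auto simp: nsets_def)
    ultimately show "card {r \<in> ?R. \<forall>a<t. r a \<in> common_rows n M T \<inter> Bad T} \<le> B ^ t"
      by (simp add: card_PiE power_mono)
  qed
  also have "\<dots> = (n choose t) * B ^ t" by simp
  also have "\<dots> \<le> n ^ t * B ^ t"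
    \<comment> \<open>\<open>binomial_le_pow\<close> needs \<open>t \<le> n\<close>; otherwise the
      binomial coefficient is 0.\<close>
    by (metis binomial_eq_0_iff binomial_le_pow le0 linorder_not_less mult_le_mono1)
  finally have "(\<Sum>r\<in>?R. card (E r)) \<le> n ^ t * B ^ t" .
  from of_nat_mono[OF this, where 'a = real]
  have E_le: "(\<Sum>r\<in>?R. real (card (E r))) \<le> real n ^ t * real B ^ t" by simp
  \<comment> \<open>\<open>c\<close> bounds the average of \<open>card (U r) - card (E r)\<close>
    over the \<open>n ^ t\<close> tuples from below, so some tuple attains it.\<close>
  define c where "c = real n * m ^ t / real n ^ t - real B ^ t"
  have "\<exists>r\<in>?R. c \<le> real (card (U r)) - real (card (E r))"
  proof (rule ccontr)
    assume "\<not> ?thesis"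
    then have "(\<Sum>r\<in>?R. real (card (U r)) - real (card (E r))) < (\<Sum>r\<in>?R. c)"
      using finR n by (intro sum_strict_mono) (auto simp: PiE_eq_empty_iff not_le)
    also have "\<dots> = real n * m ^ t - real n ^ t * real B ^ t"
      using cardR n by (simp add: c_def algebra_simps)
    finally show False using U_ge E_le by (simp add: sum_subtractf)
  qed
  then obtain r where rR: "r \<in> ?R" and r: "c \<le> real (card (U r)) - real (card (E r))" by blast
  \<comment> \<open>Every \<open>T\<close> in \<open>E r\<close> is nonempty as \<open>t > 0\<close>
    and loses a column, so none survives inside \<open>V\<close>; at most \<open>card (E r)\<close>
    columns are lost.\<close>
  define V where "V = U r - (\<lambda>T. SOME j. j \<in> T) ` E r"
  have finE: "finite (E r)" using finS by (simp add: E_def)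
  show thesis
  proof
    show "V \<subseteq> {..<n}" by (auto simp: V_def U_def)
    have "card (U r) \<le> card V + card (E r)"
      unfolding V_def using diff_card_le_card_Diff[of "(\<lambda>T. SOME j. j \<in> T) ` E r" "U r"] finE
        card_image_le[OF finE, of "\<lambda>T. SOME j. j \<in> T"] by simp
    then have "real n * m ^ t / real n ^ t \<le> real (card V) + real B ^ t"
      using r by (simp add: c_def)
    then show "real n * m ^ t \<le> real n ^ t * (real (card V) + real B ^ t)"
      using n by (simp add: field_simps)
  next
    fix T assume T: "T \<in> nsets V t"
    then have "T \<noteq> {}" using t by (auto simp: nsets_def)
    then have "(SOME j. j \<in> T) \<in> T" by (simp add: some_in_eq)
    then have "T \<notin> E r" using T by (auto simp: nsets_def V_def)
    moreover have "T \<in> ?S" using T by (auto simp: nsets_def V_def U_def)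
    ultimately obtain a where a: "a < t" "r a \<notin> common_rows n M T \<inter> Bad T"
      by (auto simp: E_def)
    have "r a \<in> common_rows n M T"
      using T a rR by (auto simp: nsets_def V_def U_def common_rows_def)
    then show "\<exists>a<t. r a \<in> common_rows n M T - Bad T"
      using a by blast
  qed
qed

section \<open>Embedding the pattern into a homogeneous column set\<close>

lemma sorted_list_of_set_nth_less:
  fixes H :: "nat set"
  assumes "i < j" "j < card H"
  shows "sorted_list_of_set H ! i < sorted_list_of_set H ! j"
  using assms strict_sorted_list_of_set[of H] by (simp add: sorted_wrt_nth_less)

lemma sorted_list_of_set_nth_mem:
  fixes H :: "nat set"
  assumes "i < card H"
  shows "sorted_list_of_set H ! i \<in> H"
proof -
  have "finite H" using assms card.infinite by fastforce
  then show ?thesis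
    using assms nth_mem[of i "sorted_list_of_set H"] by simp
qed

text \<open>Columns come from \<open>H\<close>, and row \<open>i\<close> of \<open>A\<close> goes to
  a row in the window of the \<open>i\<close>-th level of \<open>G\<close>. Since
  \<open>\<rho>\<close> is the same for all \<open>T\<close>, the order of the levels orders the
  rows.\<close>

lemma contains_if_homogeneous:
  assumes A: "\<And>i. i < k \<Longrightarrow> card {j. j < l \<and> A i j} \<le> t"
    and H: "finite H" "H \<subseteq> {..<n}" "card H = l + t"
    and G: "k \<le> card G"
    and hom: "\<And>T. T \<in> nsets H t \<Longrightarrow> active_levels s L (common_rows n M T) \<rho> = G"
  shows "contains n n M k l A"
proof -
  define c where "c j = sorted_list_of_set H ! j" for j
  define lev where "lev i = sorted_list_of_set G ! i" for i
  have c_mem: "c j \<in> H" if "j < l" for j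
    using that H sorted_list_of_set_nth_mem[of j H] by (simp add: c_def)
  have c_less: "c i < c j" if "i < j" "j < l" for i j
    using that H sorted_list_of_set_nth_less[of i j H] by (simp add: c_def)
  have lev_mem: "lev i \<in> G" if "i < k" for i
    using that G sorted_list_of_set_nth_mem[of i G] by (simp add: lev_def)
  have lev_less: "lev i < lev j" if "i < j" "j < k" for i j
    using that G sorted_list_of_set_nth_less[of i j G]
    by (simp add: lev_def)
  have "\<exists>x. x < n \<and> x \<in> digit_window s \<rho> (lev i) \<and> (\<forall>j<l. A i j \<longrightarrow> M x (c j))" if i: "i < k" for i
  proof -
    let ?J = "c ` {j. j < l \<and> A i j}"
    have "card ?J \<le> t" using A[OF i] card_image_le[of "{j. j < l \<and> A i j}" c] by simp
    moreover have "?J \<subseteq> H" using c_mem by auto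
    \<comment> \<open>\<open>card H = l + t\<close> leaves room to pad the at most \<open>t\<close>
      columns used by row \<open>i\<close> to a \<open>t\<close>-set, to which homogeneity
      applies.\<close>
    ultimately obtain T where T: "?J \<subseteq> T" "T \<subseteq> H" "card T = t"
      using H exists_subset_between[of ?J t H] by auto
    then have "T \<in> nsets H t"
      using H finite_subset by (auto simp: nsets_def)
    then have "lev i \<in> active_levels s L (common_rows n M T) \<rho>"
      using hom lev_mem[OF i] by simp
    then obtain x where "x \<in> common_rows n M T" "x \<in> digit_window s \<rho> (lev i)"
      by (auto simp: active_levels_def)
    then show ?thesis using T by (auto simp: common_rows_def)
  qed
  then obtain x where x: "\<And>i. i < k \<Longrightarrow> x i < n" "\<And>i. i < k \<Longrightarrow> x i \<in> digit_window s \<rho> (lev i)"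
    "\<And>i j. i < k \<Longrightarrow> j < l \<Longrightarrow> A i j \<Longrightarrow> M (x i) (c j)"
    by metis
  have "x i < x j" if "i < j" "j < k" for i j
    using digit_window_less[OF lev_less[OF that], of "x i" s \<rho> "x j"] x(2) that by simp
  then show ?thesis
    unfolding contains_def using x c_mem c_less H
    by (intro exI[where x = x] exI[where x = c] conjI) (auto simp: subset_iff)
qed

text \<open>A colour is an index below \<open>t\<close> together with a set of levels below
  \<open>L\<close>; hence \<open>N\<close> is uniform in \<open>n\<close>, \<open>s\<close> and
  \<open>M\<close>.\<close>

lemma contains_if_large_good_set:
  obtains N where "\<And>n s M A V r.
    \<lbrakk>\<And>i. i < k \<Longrightarrow> card {j. j < l \<and> A i j} \<le> t; V \<subseteq> {..<n}; N \<le> card V;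
     \<And>T. T \<in> nsets V t \<Longrightarrow> \<exists>a<t. k \<le> card (active_levels s L (common_rows n M T) (r a))\<rbrakk>
    \<Longrightarrow> contains n n M k l A"
proof -
  let ?C = "{..<t} \<times> Pow {..<L}"
  obtain N where N: "\<And>(V :: nat set) f. \<lbrakk>finite V; N \<le> card V; \<And>T. T \<in> nsets V t \<Longrightarrow> f T \<in> ?C\<rbrakk>
    \<Longrightarrow> \<exists>H \<in> nsets V (l + t). \<exists>c \<in> ?C. \<forall>T \<in> nsets H t. f T = c"
    by (rule ramsey_colouring[of ?C t "l + t"]) auto
  show thesis
  proof (rule that)
    fix n s M A V and r :: "nat \<Rightarrow> nat"
    assume A: "\<And>i. i < k \<Longrightarrow> card {j. j < l \<and> A i j} \<le> t"
      and V: "V \<subseteq> {..<n}" "N \<le> card V"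
      and "\<And>T. T \<in> nsets V t \<Longrightarrow> \<exists>a<t. k \<le> card (active_levels s L (common_rows n M T) (r a))"
    then obtain a where a: "\<And>T. T \<in> nsets V t \<Longrightarrow> a T < t"
      "\<And>T. T \<in> nsets V t \<Longrightarrow> k \<le> card (active_levels s L (common_rows n M T) (r (a T)))"
      by metis
    define f where "f T = (a T, active_levels s L (common_rows n M T) (r (a T)))" for T
    have finV: "finite V" using V finite_subset by blast
    have "f T \<in> ?C" if "T \<in> nsets V t" for T
      using a that by (auto simp: f_def active_levels_def)
    then obtain H b G where H: "H \<in> nsets V (l + t)" and hom: "\<And>T. T \<in> nsets H t \<Longrightarrow> f T = (b, G)"
      using N[OF finV V(2), of f] by auto
    have sub: "nsets H t \<subseteq> nsets V t" using H by (auto simp: nsets_def)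
    \<comment> \<open>One \<open>t\<close>-subset of \<open>H\<close> is needed to carry the bound
      on active levels over to \<open>G\<close>.\<close>
    obtain T where "T \<subseteq> H" "card T = t" "finite T"
      using H obtain_subset_with_card_n[of t H] by (auto simp: nsets_def)
    then have "T \<in> nsets H t" by (simp add: nsets_def)
    then have "k \<le> card G"
      using a(2)[of T] hom[of T] sub by (auto simp: f_def)
    then show "contains n n M k l A"
    proof (rule contains_if_homogeneous[rotated 4])
      show "active_levels s L (common_rows n M T) (r b) = G" if "T \<in> nsets H t" for T
        using hom[OF that] by (auto simp: f_def)
    qed (use A H V in \<open>auto simp: nsets_def\<close>)
  qed
qed

section \<open>Choice of parameters\<close>

lemma nat_le_root_power:
  assumes "L > 0"
  shows "n \<le> (nat \<lfloor>real n powr (1 / real L)\<rfloor> + 1) ^ L"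
proof (cases "n = 0")
  case False
  then have "real n = (real n powr (1 / real L)) ^ L"
    using assms by (simp add: powr_realpow[symmetric] powr_powr)
  also have "\<dots> \<le> real (nat \<lfloor>real n powr (1 / real L)\<rfloor> + 1) ^ L"
    by (intro power_mono) (auto, linarith)
  finally show ?thesis
    by (metis of_nat_le_iff of_nat_power)
qed simp

theorem contains_if_weight_ge:
  fixes \<epsilon> :: real
  assumes A: "\<And>i. i < k \<Longrightarrow> card {j. j < l \<and> A i j} \<le> t" and t: "t > 0" and \<epsilon>: "\<epsilon> > 0"
  shows "\<exists>n0. \<forall>n\<ge>n0. \<forall>M. real n powr (2 - 1 / real t + \<epsilon>) \<le> weight n n M \<longrightarrow> contains n n M k l A"
proof -
  \<comment> \<open>This gives \<open>k / L \<le> \<epsilon> / 2\<close>, so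
    \<open>2 ^ L * s ^ k\<close> is at most a constant times
    \<open>n powr (\<epsilon> / 2)\<close>.\<close>
  define L where "L = nat \<lceil>2 * real k / \<epsilon>\<rceil> + 1"
  have L: "L > 0" "2 * real k / \<epsilon> \<le> real L" by (auto simp: L_def) linarith
  obtain N where N: "\<And>n s M A V r.
    \<lbrakk>\<And>i. i < k \<Longrightarrow> card {j. j < l \<and> A i j} \<le> t; V \<subseteq> {..<n}; N \<le> card V;
     \<And>T. T \<in> nsets V t \<Longrightarrow> \<exists>a<t. k \<le> card (active_levels s L (common_rows n M T) (r a))\<rbrakk>
    \<Longrightarrow> contains n n M k l A"
    using contains_if_large_good_set[of k l t L] by blast
  define \<delta> where "\<delta> = real t * \<epsilon> / 2"
  have \<delta>: "\<delta> > 0" using t \<epsilon> by (simp add: \<delta>_def)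
  define K where "K = ((2::real) ^ L * 2 ^ k) ^ t"
  \<comment> \<open>If \<open>y \<ge> Z\<close>, then \<open>y \<ge> 1\<close> and
    \<open>y - K \<ge> N\<close>, hence \<open>y * (y - K) \<ge> N\<close>.\<close>
  define Z where "Z = K + real N + 1"
  have K: "K > 0" by (simp add: K_def)
  show ?thesis
  proof (intro exI allI impI)
    fix n M
    assume n: "nat \<lceil>Z powr (1 / \<delta>)\<rceil> + 1 \<le> n"
      and w: "real n powr (2 - 1 / real t + \<epsilon>) \<le> weight n n M"
    define y where "y = real n powr \<delta>"
    \<comment> \<open>Adding 1 to the floor ensures \<open>n \<le> s ^ L\<close>, so
      \<open>L\<close> digits suffice for every row index.\<close>
    define s where "s = nat \<lfloor>real n powr (1 / real L)\<rfloor> + 1"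
    define m where "m = real n powr (1 - 1 / real t + \<epsilon>)"
    have n1: "n \<ge> 1" using n by simp
    have "Z = (Z powr (1 / \<delta>)) powr \<delta>"
      using \<delta> K by (simp add: powr_powr Z_def)
    also have "\<dots> \<le> y"
      unfolding y_def using n \<delta> by (intro powr_mono2) (auto, linarith)
    finally have y: "Z \<le> y" .
    have "1 \<le> real n powr (1 / real L)"
      using n1 L by (intro ge_one_powr_ge_zero) auto
    then have "real s \<le> 2 * real n powr (1 / real L)"
      unfolding s_def by linarith
    then have "real s ^ k \<le> (2 * real n powr (1 / real L)) ^ k"
      by (intro power_mono) auto
    then have "real (2 ^ L * s ^ k) \<le> 2 ^ L * 2 ^ k * (real n powr (1 / real L)) ^ k"
      by (simp add: power_mult_distrib)
    also have "(real n powr (1 / real L)) ^ k = real n powr (real k / real L)"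
      using n1 by (simp add: powr_realpow[symmetric] powr_powr)
    also have "real n powr (real k / real L) \<le> real n powr (\<epsilon> / 2)"
      using n1 L \<epsilon> by (intro powr_mono) (auto simp: field_simps)
    finally have "real (2 ^ L * s ^ k) \<le> 2 ^ L * 2 ^ k * real n powr (\<epsilon> / 2)"
      by simp
    then have "real (2 ^ L * s ^ k) ^ t \<le> (2 ^ L * 2 ^ k * real n powr (\<epsilon> / 2)) ^ t"
      by (intro power_mono) auto
    also have "\<dots> = K * y"
      using n1 by (simp add: K_def y_def \<delta>_def power_mult_distrib powr_realpow[symmetric] powr_powr
          mult.commute)
    finally have B: "real (2 ^ L * s ^ k) ^ t \<le> K * y" .
    have m: "m > 0" using n1 by (simp add: m_def)
    have w': "real n * m \<le> weight n n M"
    proof -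
      have "real n * m = real n powr (1 + (1 - 1 / real t + \<epsilon>))"
        unfolding powr_add[of _ 1] using n1 by (simp add: m_def)
      also have "1 + (1 - 1 / real t + \<epsilon>) = 2 - 1 / real t + \<epsilon>" by simp
      finally show ?thesis using w by simp
    qed
    \<comment> \<open>The \<open>1 / t\<close> in the exponent exactly absorbs the factor
      \<open>n\<close>. What remains is \<open>y * y\<close>, against only \<open>K * y\<close> for
      the exceptional rows.\<close>
    have mt: "real n * m ^ t = real n ^ t * (y * y)"
    proof -
      have "real n * m ^ t = real n powr (1 + (1 - 1 / real t + \<epsilon>) * real t)"
        using n1 m by (simp only: powr_realpow[OF m, symmetric]) (simp only: m_def powr_powr powr_add[of _ 1], simp)
      also have "1 + (1 - 1 / real t + \<epsilon>) * real t = real t + (\<delta> + \<delta>)"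
        using t by (simp add: \<delta>_def field_simps)
      also have "real n powr (real t + (\<delta> + \<delta>)) = real n powr real t * (y * y)"
        by (simp only: y_def powr_add)
      finally show ?thesis
        using n1 by (simp add: powr_realpow)
    qed
    define Bad where
      "Bad T = {\<rho>. card (active_levels s L (common_rows n M T) \<rho>) < k}" for T
    have few: "card (common_rows n M T \<inter> Bad T) \<le> 2 ^ L * s ^ k" for T
    proof -
      have "common_rows n M T \<subseteq> {..<s ^ L}"
        using nat_le_root_power[OF L(1), of n] by (auto simp: common_rows_def s_def)
      then show ?thesis
        using card_few_active_levels[of "common_rows n M T" s L k]
        by (simp add: Bad_def s_def Int_def)
    qed
    obtain V r where V: "V \<subseteq> {..<n}"
      "real n * m ^ t \<le> real n ^ t * (real (card V) + real (2 ^ L * s ^ k) ^ t)"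
      and good: "\<And>T. T \<in> nsets V t \<Longrightarrow> \<exists>a<t. r a \<in> common_rows n M T - Bad T"
      using dependent_random_choice[OF _ t m w' few] n1 by auto
    have "y * y \<le> real (card V) + real (2 ^ L * s ^ k) ^ t"
      using V(2) n1 by (simp add: mt)
    then have "y * y - K * y \<le> real (card V)" using B by linarith
    moreover have "real N \<le> y * y - K * y"
    proof -
      have "1 * real N \<le> y * (y - K)"
        using y K by (intro mult_mono) (auto simp: Z_def)
      then show ?thesis by (simp add: algebra_simps)
    qed
    ultimately have "N \<le> card V" by linarith
    moreover have "\<exists>a<t. k \<le> card (active_levels s L (common_rows n M T) (r a))"
      if "T \<in> nsets V t" for T
      using good[OF that] by (auto simp: Bad_def not_less)
    ultimately show "contains n n M k l A"
      using N[where A = A and V = V and s = s and M = M and r = r, OF _ V(1)] A by blast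
  qed
qed

section \<open>From partite matrices to the bound on \<open>ex\<close>\<close>

text \<open>The \<open>t\<close> column intervals cover the row, and each holds at most one of its
  one-entries.\<close>

lemma col_partite_row_weight:
  assumes "col_partite t k l A" "i < k"
  shows "card {j. j < l \<and> A i j} \<le> t"
proof -
  obtain b where b: "b 0 = 0" "b t = l"
    and one: "\<And>s j1 j2. \<lbrakk>s < t; b s \<le> j1; j1 < j2; j2 < b (Suc s)\<rbrakk> \<Longrightarrow> \<not> (A i j1 \<and> A i j2)"
    using assms unfolding col_partite_def by metis
  let ?J = "\<lambda>s. {j \<in> {b s..<b (Suc s)}. A i j}"
  have "\<exists>s<u. b s \<le> j \<and> j < b (Suc s)" if "j < b u" for u j
    using that
  proof (induction u)
    case (Suc u)
    then show ?case by (cases "j < b u") (auto simp: less_Suc_eq not_less)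
  qed (simp add: b)
  then have "{j. j < l \<and> A i j} \<subseteq> (\<Union>s<t. ?J s)"
    using b by fastforce
  then have "card {j. j < l \<and> A i j} \<le> card (\<Union>s<t. ?J s)"
    by (intro card_mono) auto
  also have "\<dots> \<le> (\<Sum>s<t. card (?J s))" by (intro card_UN_le) auto
  also have "\<dots> \<le> (\<Sum>s<t. 1)"
  proof (rule sum_mono)
    fix s assume "s \<in> {..<t}"
    then have "x = y" if "x \<in> ?J s" "y \<in> ?J s" for x y
      using that one[of s x y] one[of s y x] by (cases x y rule: linorder_cases) auto
    then show "card (?J s) \<le> 1" by (simp add: card_le_Suc0_iff_eq)
  qed
  finally show ?thesis by simp
qed

lemma weight_le: "weight n n M \<le> n * n"
proof -
  have "weight n n M \<le> card ({..<n} \<times> {..<n})"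
    unfolding weight_def by (intro card_mono) auto
  then show ?thesis by simp
qed

theorem theorem1p2:
  fixes t k l :: nat and A :: "nat \<Rightarrow> nat \<Rightarrow> bool"
  assumes "t \<ge> 2"
    and "zo_matrix k l A"
    and "tt_partite t k l A"
  shows "\<forall>\<epsilon>>0. \<exists>n0. \<forall>n\<ge>n0. real (ex n k l A) < real n powr (2 - 1 / real t + \<epsilon>)"
proof (intro allI impI)
  fix \<epsilon> :: real assume \<epsilon>: "\<epsilon> > 0"
  have "card {j. j < l \<and> A i j} \<le> t" if "i < k" for i
    using assms(3) that col_partite_row_weight by (auto simp: tt_partite_def)
  then obtain n0 where n0: "\<And>n M. n0 \<le> n \<Longrightarrow> real n powr (2 - 1 / real t + \<epsilon>) \<le> weight n n M
      \<Longrightarrow> contains n n M k l A"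
    using contains_if_weight_ge[of k l A t \<epsilon>] assms(1) \<epsilon> by auto
  show "\<exists>n0. \<forall>n\<ge>n0. real (ex n k l A) < real n powr (2 - 1 / real t + \<epsilon>)"
  proof (intro exI allI impI)
    \<comment> \<open>\<open>n0 + 1\<close> makes \<open>n\<close> positive, so the strict bound
      also holds when the maximum is the inserted 0.\<close>
    fix n assume n: "n0 + 1 \<le> n"
    let ?W = "{weight n n M | M. zo_matrix n n M \<and> \<not> contains n n M k l A}"
    have "?W \<subseteq> {..n * n}" using weight_le by auto
    then have "finite (insert 0 ?W)" using finite_subset by blast
    then have "ex n k l A \<in> insert 0 ?W"
      unfolding ex_def by (intro Max_in) auto
    then show "real (ex n k l A) < real n powr (2 - 1 / real t + \<epsilon>)"
      using n0[of n] n by (auto simp: not_le[symmetric])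
  qed
qed

end
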